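(* Let $(M,d)$ be an ultrametric space and let $A,B\subseteq M$ be nonempty spherically complete subsets such that $B$ is bounded and $\delta(B)\le\mathrm{dist}(A,B)$. Let $T:A\cup B\to A\cup B$ be a noncyclic nonexpansive mapping which has the weak-regular property. Then there exist $a\in A$ and $b\in B$ such that $$Ta=a,\qquad Tb=b\qquad\text{and}\qquad d(a,b)=\mathrm{dist}(A,B).$$
   Context: An ultrametric space is a metric space $(M,d)$ with $d(x,y)\le\max\{d(x,z),d(z,y)\}$ for all $x,y,z\in M$. An ultrametric space is spherically complete if each nested sequence of (closed) balls $B_1\supseteq B_2\supseteq\cdots$ has nonempty intersection; a subset of $M$ is spherically complete if it is so as a subspace with the induced metric. For a bounded set $B$, $\delta(B)=\sup\{d(x,y): x,y\in B\}$, and $\mathrm{dist}(A,B)=\inf\{d(a,b): a\in A,\ b\in B\}$. A map $T:A\cup B\to A\cup B$ is noncyclic if $T(A)\subseteq A$ and $T(B)\subseteq B$, and nonexpansive if $d(Tx,Ty)\le d(x,y)$ for all $x,y\in A\cup B$. It has the weak-regular property if $\limsup_{n\to\infty} d(T^nx,T^{n+1}x)<d(x,Tx)$ for each $x\in A\cup B$ with $x\neq Tx$. *)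

theory Defs
  imports "HOL-Analysis.Analysis"
begin

locale Ultrametric_space = Metric_space +
  assumes ultrametric: "\<lbrakk>x \<in> M; y \<in> M; z \<in> M\<rbrakk> \<Longrightarrow> d x y \<le> max (d x z) (d z y)"

text \<open>
  Radii are required to be nonnegative, since \<open>mcball\<close> with a negative radius is empty.
  A subset \<open>A\<close> of \<open>M\<close> is spherically complete as a subspace iff
  \<open>Metric_space.spherically_complete A d\<close>; the balls are then those of \<open>A\<close>, with centres in \<open>A\<close>.
\<close>

definition (in Metric_space) spherically_complete :: bool where
  "spherically_complete \<longleftrightarrow>
     (\<forall>C :: nat \<Rightarrow> 'a set.
        (\<forall>n. \<exists>x\<in>M. \<exists>r\<ge>0. C n = mcball x r) \<and> (\<forall>n. C (Suc n) \<subseteq> C n)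
          \<longrightarrow> (\<Inter>n. C n) \<noteq> {})"

text \<open>
  The library's \<open>diameter\<close> and \<open>setdist\<close> are tied to the type class \<open>metric_space\<close>; these are
  their counterparts for an explicit metric, meaningful for nonempty sets (and, for the diameter,
  bounded ones).
\<close>

definition mdiameter :: "('a \<Rightarrow> 'a \<Rightarrow> real) \<Rightarrow> 'a set \<Rightarrow> real" where
  "mdiameter d S = (SUP (x, y) \<in> S \<times> S. d x y)"

definition msetdist :: "('a \<Rightarrow> 'a \<Rightarrow> real) \<Rightarrow> 'a set \<Rightarrow> 'a set \<Rightarrow> real" where
  "msetdist d A B = (INF (a, b) \<in> A \<times> B. d a b)"

definition noncyclic :: "'a set \<Rightarrow> 'a set \<Rightarrow> ('a \<Rightarrow> 'a) \<Rightarrow> bool" where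
  "noncyclic A B T \<longleftrightarrow> T ` A \<subseteq> A \<and> T ` B \<subseteq> B"

definition nonexpansive_on :: "'a set \<Rightarrow> ('a \<Rightarrow> 'a \<Rightarrow> real) \<Rightarrow> ('a \<Rightarrow> 'a) \<Rightarrow> bool" where
  "nonexpansive_on S d T \<longleftrightarrow> (\<forall>x\<in>S. \<forall>y\<in>S. d (T x) (T y) \<le> d x y)"

definition weak_regular_on :: "'a set \<Rightarrow> ('a \<Rightarrow> 'a \<Rightarrow> real) \<Rightarrow> ('a \<Rightarrow> 'a) \<Rightarrow> bool" where
  "weak_regular_on S d T \<longleftrightarrow>
     (\<forall>x\<in>S. x \<noteq> T x \<longrightarrow>
        limsup (\<lambda>n. ereal (d ((T ^^ n) x) ((T ^^ Suc n) x))) < ereal (d x (T x)))"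

end

theory Submission
  imports Defs
begin

text \<open>
  Call a function \<open>\<phi>\<close> that does not increase on passing from a point \<open>x\<close> to a point of the ball of
  radius \<open>\<phi> x\<close> around \<open>x\<close> a gauge. In a spherically complete space, choosing nearly minimal values of
  a gauge along such balls produces a nested sequence, and the gauge is constant on the ball of
  radius \<open>\<phi> z\<close> around any point \<open>z\<close> of its intersection.

  For nonexpansive \<open>T\<close> the displacement \<open>d x (T x)\<close> is a gauge, and the ball around \<open>z\<close> is
  \<open>T\<close>-invariant, so the displacement is constant along the orbit of \<open>z\<close>; weak regularity then
  forces \<open>T z = z\<close>. The distance to a fixed point of \<open>B\<close> is a gauge on \<open>A\<close>, so it is minimised at some
  \<open>z\<close>. Since \<open>\<delta>(B) \<le> dist(A,B)\<close>, the distance from \<open>a \<in> A\<close> to a point of \<open>B\<close> does not depend on that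
  point. Hence the points of \<open>A\<close> at distance \<open>dist(A,B)\<close> from \<open>B\<close> form a \<open>T\<close>-invariant ball of \<open>A\<close>,
  on which the fixed point argument applies again.
\<close>

lemma Ultrametric_space_subset:
  assumes "Ultrametric_space M d" and "S \<subseteq> M"
  shows "Ultrametric_space S d"
proof -
  interpret Ultrametric_space M d by fact
  interpret S: Metric_space S d using assms(2) by (rule subspace)
  show ?thesis
    by unfold_locales (use assms(2) ultrametric in blast)
qed

context Ultrametric_space
begin

text \<open>Serves to nest the gauge balls below, whose radii \<open>\<phi>\<close> do not
  increase.\<close>

lemma mcball_subset_mcball:
  assumes "y \<in> mcball x r" and "s \<le> r"
  shows "mcball y s \<subseteq> mcball x r"
proof
  fix w assume "w \<in> mcball y s"
  then show "w \<in> mcball x r"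
    using assms ultrametric[of x w y] by auto
qed

text \<open>A ball of radius \<open>s\<close> of the subspace \<open>mcball x r\<close> is the ball of radius \<open>min s r\<close> of the whole
  space.\<close>

lemma spherically_complete_mcball:
  assumes sc: spherically_complete and "r \<ge> 0"
  shows "Metric_space.spherically_complete (mcball x r) d"
proof -
  interpret S: Metric_space "mcball x r" d
    by (rule subspace) auto
  have ball_eq: "S.mcball y s = mcball y (min s r)" if "y \<in> mcball x r" for y s
  proof -
    have "w \<in> mcball x r \<longleftrightarrow> d y w \<le> r" if "w \<in> M" for w
      using that \<open>y \<in> mcball x r\<close> ultrametric[of x w y] ultrametric[of y w x]
      by (auto simp: commute)
    then show ?thesis
      using that by (intro set_eqI) (simp only: S.in_mcball in_mcball min.bounded_iff, blast)
  qed
  show ?thesis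
    unfolding S.spherically_complete_def
  proof (intro allI impI, elim conjE)
    fix C :: "nat \<Rightarrow> 'a set"
    assume C: "\<forall>n. \<exists>y\<in>mcball x r. \<exists>s\<ge>0. C n = S.mcball y s"
      and nested: "\<forall>n. C (Suc n) \<subseteq> C n"
    have "\<exists>y\<in>M. \<exists>s\<ge>0. C n = mcball y s" for n
    proof -
      obtain y s where "y \<in> mcball x r" "s \<ge> 0" "C n = S.mcball y s"
        using C by blast
      then have "y \<in> M" "min s r \<ge> 0" "C n = mcball y (min s r)"
        using ball_eq \<open>r \<ge> 0\<close> by auto
      then show ?thesis by blast
    qed
    then show "(\<Inter>n. C n) \<noteq> {}"
      using sc nested unfolding spherically_complete_def by blast
  qed
qed

lemma gauge_constant_on_mcball:
  fixes \<phi> :: "'a \<Rightarrow> real"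
  assumes sc: spherically_complete and "M \<noteq> {}"
    and nonneg: "\<And>x. x \<in> M \<Longrightarrow> \<phi> x \<ge> 0"
    and gauge: "\<And>x y. x \<in> M \<Longrightarrow> y \<in> mcball x (\<phi> x) \<Longrightarrow> \<phi> y \<le> \<phi> x"
  obtains z where "z \<in> M" and "\<And>y. y \<in> mcball z (\<phi> z) \<Longrightarrow> \<phi> y = \<phi> z"
proof -
  \<comment> \<open>The infimum of \<open>\<phi>\<close> on the ball need not be attained, so a
    tolerance tending to 0 is allowed.\<close>
  define step where "step n x y \<longleftrightarrow> y \<in> mcball x (\<phi> x) \<and>
      (\<forall>w\<in>mcball x (\<phi> x). \<phi> y \<le> \<phi> w + inverse (real (Suc n)))" for n x y
  have step_ex: "\<exists>y. y \<in> M \<and> step n x y" if "x \<in> M" for x n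
  proof -
    let ?V = "\<phi> ` mcball x (\<phi> x)"
    have ne: "?V \<noteq> {}" using that nonneg by auto
    have lt: "Inf ?V < Inf ?V + inverse (real (Suc n))" by simp
    obtain y where "y \<in> mcball x (\<phi> x)" and "\<phi> y < Inf ?V + inverse (real (Suc n))"
      using cInf_lessD[OF ne lt] by blast
    moreover have "bdd_below ?V"
      by (rule bdd_belowI2[of _ 0]) (use nonneg in auto)
    then have "Inf ?V \<le> \<phi> w" if "w \<in> mcball x (\<phi> x)" for w
      using that by (intro cInf_lower) auto
    ultimately show ?thesis
      unfolding step_def by (intro exI[of _ y]) fastforce
  qed
  obtain x where x: "\<And>n. x n \<in> M" "\<And>n. step n (x n) (x (Suc n))"
    using dependent_nat_choice[of "\<lambda>n y. y \<in> M" step] step_ex \<open>M \<noteq> {}\<close> by blast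
  let ?C = "\<lambda>n. mcball (x n) (\<phi> (x n))"
  have "?C (Suc n) \<subseteq> ?C n" for n
    using x[of n] gauge by (intro mcball_subset_mcball) (auto simp: step_def)
  then have "(\<Inter>n. ?C n) \<noteq> {}"
    by (intro sc[unfolded spherically_complete_def, rule_format] conjI allI)
      (use x(1) nonneg in blast)+
  then obtain z where z: "\<And>n. z \<in> ?C n" by blast
  show thesis
  proof
    show "z \<in> M" using z[of 0] by simp
    show "\<phi> y = \<phi> z" if y: "y \<in> mcball z (\<phi> z)" for y
    proof (rule antisym)
      show "\<phi> y \<le> \<phi> z" using gauge \<open>z \<in> M\<close> y by blast
      have le: "\<phi> z \<le> \<phi> (x n)" for n using gauge x(1) z by blast
      \<comment> \<open>\<open>y\<close> lies in every ball of the sequence, hence competes in the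
        choice of each \<open>x (Suc n)\<close>, while \<open>\<phi> z\<close> is at most
        \<open>\<phi> (x (Suc n))\<close>.\<close>
      have "\<phi> z - \<phi> y \<le> inverse (real (Suc n))" for n
      proof -
        have "y \<in> ?C n" using mcball_subset_mcball[OF z le] y by blast
        then have "\<phi> (x (Suc n)) \<le> \<phi> y + inverse (real (Suc n))"
          using x(2)[of n] unfolding step_def by blast
        with le[of "Suc n"] show ?thesis by linarith
      qed
      then have "\<phi> z - \<phi> y \<le> 0"
        by (intro LIMSEQ_le_const[OF LIMSEQ_inverse_real_of_nat]) auto
      then show "\<phi> z \<le> \<phi> y" by simp
    qed
  qed
qed

lemma weak_regular_fixpoint:
  assumes sc: spherically_complete and "M \<noteq> {}"
    and T: "T \<in> M \<rightarrow> M"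
    and nonexp: "nonexpansive_on M d T" and reg: "weak_regular_on M d T"
  obtains z where "z \<in> M" and "T z = z"
proof -
  have TM: "T x \<in> M" if "x \<in> M" for x using T that by blast
  have contr: "d (T x) (T y) \<le> d x y" if "x \<in> M" "y \<in> M" for x y
    using nonexp that by (auto simp: nonexpansive_on_def)
  \<comment> \<open>Go from \<open>x\<close> to \<open>T y\<close> through \<open>T x\<close>: both
    legs are at most \<open>d x (T x)\<close>.\<close>
  have inv: "T y \<in> mcball x (d x (T x))" if "x \<in> M" "y \<in> mcball x (d x (T x))" for x y
    using that TM contr[of x y] ultrametric[of x "T y" "T x"] by auto
  have gauge: "d y (T y) \<le> d x (T x)" if "x \<in> M" "y \<in> mcball x (d x (T x))" for x y
    using that TM inv[OF that] ultrametric[of y "T y" x] by (auto simp: commute)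
  obtain z where z: "z \<in> M"
    and const: "\<And>y. y \<in> mcball z (d z (T z)) \<Longrightarrow> d y (T y) = d z (T z)"
    using gauge_constant_on_mcball[of "\<lambda>x. d x (T x)"] sc \<open>M \<noteq> {}\<close> gauge by auto
  have orbit: "(T ^^ n) z \<in> mcball z (d z (T z))" for n
    by (induction n) (use z inv in auto)
  have "T z = z"
  proof (rule ccontr)
    assume "T z \<noteq> z"
    then have "limsup (\<lambda>n. ereal (d ((T ^^ n) z) ((T ^^ Suc n) z))) < ereal (d z (T z))"
      using reg z unfolding weak_regular_on_def by metis
    then show False
      using const[OF orbit] by (simp add: Limsup_const)
  qed
  with z that show thesis by blast
qed

end

theorem theorem2p9:
  fixes M :: "'a set" and d :: "'a \<Rightarrow> 'a \<Rightarrow> real" and A B :: "'a set" and T :: "'a \<Rightarrow> 'a"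
  assumes "Ultrametric_space M d"
    and "A \<subseteq> M" and "B \<subseteq> M" and "A \<noteq> {}" and "B \<noteq> {}"
    and "Metric_space.spherically_complete A d"
    and "Metric_space.spherically_complete B d"
    and "Metric_space.mbounded M d B"
    and "mdiameter d B \<le> msetdist d A B"
    and "T \<in> A \<union> B \<rightarrow> A \<union> B"
    and "noncyclic A B T"
    and "nonexpansive_on (A \<union> B) d T"
    and "weak_regular_on (A \<union> B) d T"
  shows "\<exists>a\<in>A. \<exists>b\<in>B. T a = a \<and> T b = b \<and> d a b = msetdist d A B"
proof -
  interpret Ultrametric_space M d by fact
  interpret A: Ultrametric_space A d using assms(1,2) by (rule Ultrametric_space_subset)
  interpret B: Ultrametric_space B d using assms(1,3) by (rule Ultrametric_space_subset)
  let ?D = "msetdist d A B"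
  have TA: "T a \<in> A" if "a \<in> A" for a using \<open>noncyclic A B T\<close> that by (auto simp: noncyclic_def)
  have TB: "T b \<in> B" if "b \<in> B" for b using \<open>noncyclic A B T\<close> that by (auto simp: noncyclic_def)
  have nonexp: "nonexpansive_on S d T" and reg: "weak_regular_on S d T" if "S \<subseteq> A \<union> B" for S
    using assms(12,13) that unfolding nonexpansive_on_def weak_regular_on_def by blast+
  have D_le: "?D \<le> d a b" if "a \<in> A" "b \<in> B" for a b
    unfolding msetdist_def
    using that by (intro cINF_lower2[of _ _ "(a, b)"] bdd_belowI2[of _ 0]) auto
  have diam: "d b b' \<le> ?D" if "b \<in> B" "b' \<in> B" for b b'
  proof -
    obtain K where "\<And>x y. x \<in> B \<Longrightarrow> y \<in> B \<Longrightarrow> d x y \<le> K"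
      using \<open>mbounded B\<close> unfolding mbounded_alt by blast
    then have "d b b' \<le> mdiameter d B"
      unfolding mdiameter_def
      using that by (intro cSUP_upper2[of _ _ "(b, b')"] bdd_aboveI2[of _ _ K]) auto
    then show ?thesis using assms(9) by linarith
  qed
  \<comment> \<open>Detour through \<open>b'\<close>: \<open>d b' b\<close> is at most
    \<open>?D\<close>, hence at most \<open>d a b'\<close>.\<close>
  have const_le: "d a b \<le> d a b'" if "a \<in> A" "b \<in> B" "b' \<in> B" for a b b'
    using ultrametric[of a b b'] diam[of b' b] D_le[of a b'] that assms(2,3) by fastforce

  obtain b where b: "b \<in> B" "T b = b"
    using B.weak_regular_fixpoint[of T] assms(5,7) TB nonexp[of B] reg[of B] by blast
  obtain z where z: "z \<in> A"
    and z_const: "\<And>y. y \<in> A.mcball z (d z b) \<Longrightarrow> d y b = d z b"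
  proof -
    have "d y b \<le> d x b" if "x \<in> A" "y \<in> A.mcball x (d x b)" for x y
      using that ultrametric[of y b x] b assms(2,3) by (auto simp: commute)
    then show thesis
      using A.gauge_constant_on_mcball[of "\<lambda>a. d a b"] that assms(4,6) nonneg by blast
  qed
  \<comment> \<open>A closer \<open>a\<close> would lie in the ball of radius \<open>d z b\<close>
    around \<open>z\<close>, where the distance to \<open>b\<close> is constant.\<close>
  have "d z b \<le> d a b'" if "a \<in> A" "b' \<in> B" for a b'
  proof (rule ccontr)
    assume "\<not> d z b \<le> d a b'"
    then have "d a b < d z b"
      using const_le[of a b b'] that b by linarith
    moreover have "d z a \<le> max (d z b) (d a b)"
      using ultrametric[of z a b] that z b assms(2,3) by (auto simp: commute)
    ultimately show False
      using z_const[of a] that z by auto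
  qed
  then have "d z b \<le> ?D"
    unfolding msetdist_def using assms(4,5)
    by (intro cINF_greatest) auto
  then have zb: "d z b = ?D" using D_le z b by fastforce
  let ?A = "A.mcball z ?D"
  \<comment> \<open>As \<open>d z b = ?D\<close>, within distance \<open>?D\<close> of
    \<open>z\<close> and within distance \<open>?D\<close> of \<open>b\<close> are equivalent;
    \<open>D_le\<close> turns the latter into equality.\<close>
  have A_iff: "a \<in> ?A \<longleftrightarrow> a \<in> A \<and> d a b = ?D" for a
    using ultrametric[of a b z] ultrametric[of z a b] zb z b D_le[of a b]
      subsetD[OF assms(2)] subsetD[OF assms(3)]
    by (auto simp: commute)
  have T_inv: "T \<in> ?A \<rightarrow> ?A"
  proof
    fix a assume "a \<in> ?A"
    then have a: "a \<in> A" "d a b = ?D" using A_iff by auto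
    \<comment> \<open>As \<open>T b = b\<close>, this keeps \<open>T a\<close> within
      \<open>?D\<close> of \<open>b\<close>.\<close>
    have "d (T a) (T b) \<le> d a b"
      using assms(12) a b unfolding nonexpansive_on_def by blast
    then show "T a \<in> ?A"
      using A_iff a b TA D_le[of "T a" b] by auto
  qed
  interpret A0: Ultrametric_space ?A d
    by (rule Ultrametric_space_subset[OF A.Ultrametric_space_axioms]) auto
  have "?D \<ge> 0" using zb nonneg by metis
  then have "A0.spherically_complete"
    using A.spherically_complete_mcball assms(6) by blast
  moreover have "?A \<noteq> {}" using A_iff z zb by blast
  moreover have "?A \<subseteq> A \<union> B" by auto
  ultimately obtain a where "a \<in> ?A" "T a = a"
    using A0.weak_regular_fixpoint[of T] T_inv nonexp reg by blast
  then show ?thesis using A_iff b by blast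
qed

end
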